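(* Let $S$ be an idempotent semifield, let $V$ be a free $S$-module of finite rank $n$ with basis $e_1,\dots,e_n$, let $1\le d\le d'\le n$, and let $w=\sum_{I\in\binom{[n]}{d}}w_Ie_I\in\bigwedge^dV$ be a tropical Plücker vector. Then the (rank $d'$) elongation of $w$ is \[ w\wedge\left(\sum_{K\subset[n],\ |K|=d'-d}e_K\right)\in\bigwedge^{d'}V. \]
   Context: An idempotent semifield $S$ is a (commutative) semiring satisfying all axioms of a field except the existence of additive inverses, and such that $s+s=s$ for all $s\in S$; its additive and multiplicative identities are $0$ and $1$. Write $[n]=\{1,\dots,n\}$, $I+j=I\cup\{j\}$, $I-j=I\smallsetminus\{j\}$. The tropical Grassmann algebra of $V$ is $\bigwedge V:=\mathrm{Sym}\,V/\langle e_i^2\sim 0\rangle_{i=1}^n$ (quotient by the generated $S$-algebra congruence), graded by $\bigwedge V=\bigoplus_{d\ge0}\bigwedge^dV$, with commutative product $\wedge$; $\bigwedge^dV$ is free with basis $e_I=e_{i_1}\wedge\cdots\wedge e_{i_d}$, $I\in\binom{[n]}{d}$ (with $e_\varnothing=1$). A nonzero $w=\sum_I w_Ie_I\in\bigwedge^dV$ is a tropical Plücker vector if for all $A\in\binom{[n]}{d+1}$, $B\in\binom{[n]}{d-1}$ and every $p\in A\smallsetminus B$, $\sum_{i\in A\smallsetminus B}w_{A-i}w_{B+i}=\sum_{i\in A\smallsetminus B,\, i\ne p}w_{A-i}w_{B+i}$. The rank $d'$ elongation of a rank $d$ tropical Plücker vector $(w_I)_{I\in\binom{[n]}{d}}$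 is the vector $\sum_{J\in\binom{[n]}{d'}}w'_Je_J$ with $w'_J=\sum_{I\subset J,\ |I|=d}w_I$. *)

theory Defs
  imports "HOL-Library.Poly_Mapping" "HOL-Library.Cardinality"
begin

class idempotent_semifield = comm_semiring_1 +
  assumes add_idem: "a + a = a"
    and ex_inverse: "a \<noteq> 0 \<Longrightarrow> \<exists>b. a * b = 1"

(* The index set [n] is a finite type 'n with n = CARD('n).  For V free on e_i (i :: 'n) over 's,
   Sym V is the polynomial semiring in the variables e_i: a finitely supported function
   from exponent vectors to coefficients. *)

type_synonym ('n, 's) sym = "('n \<Rightarrow>\<^sub>0 nat) \<Rightarrow>\<^sub>0 's"

definition sym_var :: "'n \<Rightarrow> ('n, 's::comm_semiring_1) sym" where
  "sym_var i = Poly_Mapping.single (Poly_Mapping.single i 1) 1"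

definition sym_const :: "'s::comm_semiring_1 \<Rightarrow> ('n, 's) sym" where
  "sym_const c = Poly_Mapping.single 0 c"

definition sym_homogeneous :: "nat \<Rightarrow> ('n::finite, 's::comm_semiring_1) sym set" where
  "sym_homogeneous d =
     {p. \<forall>m \<in> Poly_Mapping.keys p. (\<Sum>i\<in>UNIV. Poly_Mapping.lookup m i) = d}"

(* The S-algebra congruence generated by e_i^2 ~ 0.  Compatibility with scalars is the
   instance of mult in which one factor is a constant. *)

inductive grassmann_cong :: "('n, 's::comm_semiring_1) sym \<Rightarrow> ('n, 's) sym \<Rightarrow> bool" where
  square: "grassmann_cong (sym_var i ^ 2) 0"
| refl: "grassmann_cong p p"
| sym: "grassmann_cong p q \<Longrightarrow> grassmann_cong q p"
| trans: "grassmann_cong p q \<Longrightarrow> grassmann_cong q r \<Longrightarrow> grassmann_cong p r"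
| add: "grassmann_cong p q \<Longrightarrow> grassmann_cong p' q' \<Longrightarrow> grassmann_cong (p + p') (q + q')"
| mult: "grassmann_cong p q \<Longrightarrow> grassmann_cong p' q' \<Longrightarrow> grassmann_cong (p * p') (q * q')"

lemma equivp_grassmann_cong: "equivp grassmann_cong"
  by (intro equivpI reflpI sympI transpI)
     (blast intro: grassmann_cong.refl grassmann_cong.sym grassmann_cong.trans)+

definition monom_of :: "'n::finite set \<Rightarrow> 'n \<Rightarrow>\<^sub>0 nat" where
  "monom_of I = (\<Sum>i\<in>I. Poly_Mapping.single i 1)"

lemma lookup_monom_of: "Poly_Mapping.lookup (monom_of I) i = (if i \<in> I then 1 else 0)"
  by (simp add: monom_of_def lookup_sum lookup_single when_def)

(* Congruent polynomials have the same coefficients at squarefree monomials, so these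
   coefficients are well defined on the quotient. *)

lemma grassmann_cong_lookup:
  assumes "grassmann_cong p q" "\<And>i. Poly_Mapping.lookup m i \<le> 1"
  shows "Poly_Mapping.lookup p m = Poly_Mapping.lookup q m"
  using assms
proof (induction arbitrary: m rule: grassmann_cong.induct)
  case (square i)
  have "Poly_Mapping.single i 1 + Poly_Mapping.single i 1 \<noteq> m"
  proof
    assume "Poly_Mapping.single i 1 + Poly_Mapping.single i 1 = m"
    then have "Poly_Mapping.lookup m i = 2"
      by (auto simp: lookup_add)
    with square[of i] show False by simp
  qed
  then show ?case
    by (simp add: sym_var_def power2_eq_square mult_single lookup_single when_def)
next
  case (mult p q p' q')
  have le: "Poly_Mapping.lookup a i \<le> 1" "Poly_Mapping.lookup b i \<le> 1" if "m = a + b" for a b i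
    using mult.prems[of i] that by (auto simp: lookup_add)
  have inner: "(\<Sum>b. (Poly_Mapping.lookup p' b when m = a + b)) =
               (\<Sum>b. (Poly_Mapping.lookup q' b when m = a + b))" for a
    by (rule Sum_any.cong) (use mult.IH(2) le in \<open>auto simp: when_def\<close>)
  have "Poly_Mapping.lookup p a * (\<Sum>b. (Poly_Mapping.lookup q' b when m = a + b)) =
        Poly_Mapping.lookup q a * (\<Sum>b. (Poly_Mapping.lookup q' b when m = a + b))" for a
  proof (cases "\<exists>b. m = a + b")
    case True
    then show ?thesis using mult.IH(1)[of a] le by metis
  next
    case False
    then have "(\<Sum>b. (Poly_Mapping.lookup q' b when m = a + b)) = 0" by simp
    then show ?thesis by (simp only: mult_zero_right)
  qed
  then show ?case by (simp add: lookup_mult inner)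
qed (auto simp: lookup_add)

quotient_type (overloaded) ('n, 's) grassmann = "('n, 's::comm_semiring_1) sym" / grassmann_cong
  by (rule equivp_grassmann_cong)

(* Multiplication on the quotient is the wedge product. *)

instantiation grassmann :: (finite, comm_semiring_1) comm_semiring_1
begin

lift_definition zero_grassmann :: "('a, 'b) grassmann" is 0 .
lift_definition one_grassmann :: "('a, 'b) grassmann" is 1 .
lift_definition plus_grassmann :: "('a, 'b) grassmann \<Rightarrow> ('a, 'b) grassmann \<Rightarrow> ('a, 'b) grassmann"
  is "(+)" by (rule grassmann_cong.add)
lift_definition times_grassmann :: "('a, 'b) grassmann \<Rightarrow> ('a, 'b) grassmann \<Rightarrow> ('a, 'b) grassmann"
  is "(*)" by (rule grassmann_cong.mult)

instance
proof
  show "(0::('a, 'b) grassmann) \<noteq> 1"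
  proof transfer
    show "\<not> grassmann_cong (0::('a, 'b) sym) 1"
      using grassmann_cong_lookup[of "0::('a, 'b) sym" 1 0] by auto
  qed
qed (transfer; simp add: algebra_simps grassmann_cong.refl)+

end

lift_definition gscale :: "'s::comm_semiring_1 \<Rightarrow> ('n::finite, 's) grassmann \<Rightarrow> ('n, 's) grassmann"
  (infixr \<open>\<odot>\<close> 75)
  is "\<lambda>c p. sym_const c * p"
  by (rule grassmann_cong.mult[OF grassmann_cong.refl])

lift_definition gvar :: "'n::finite \<Rightarrow> ('n, 's::comm_semiring_1) grassmann" is sym_var .

definition gbasis :: "'n::finite set \<Rightarrow> ('n, 's::comm_semiring_1) grassmann" where
  "gbasis I = (\<Prod>i\<in>I. gvar i)"

definition ext_power :: "nat \<Rightarrow> ('n::finite, 's::comm_semiring_1) grassmann set" where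
  "ext_power d = abs_grassmann ` sym_homogeneous d"

(* gcoord w I is the coefficient w_I of w in the basis (e_I), see grassmann_expansion and
   gcoord_sum_gbasis below. *)

lift_definition gcoord :: "('n::finite, 's::comm_semiring_1) grassmann \<Rightarrow> 'n set \<Rightarrow> 's"
  is "\<lambda>p I. Poly_Mapping.lookup p (monom_of I)"
  by (rule ext, rule grassmann_cong_lookup) (auto simp: lookup_monom_of)

lemma gvar_square: "gvar i * gvar i = 0"
  by transfer (use grassmann_cong.square in \<open>simp add: power2_eq_square\<close>)

lemma sym_var_prod:
  "(\<Prod>i\<in>I. sym_var i) = (Poly_Mapping.single (monom_of I) 1 :: ('n::finite, 's::comm_semiring_1) sym)"
proof -
  have "finite I" by simp
  then show ?thesis
    by (induction I rule: finite_induct)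
       (auto simp: monom_of_def sym_var_def mult_single)
qed

lemma abs_grassmann_prod:
  "abs_grassmann (\<Prod>i\<in>I. f i) = (\<Prod>i\<in>(I::'n::finite set). abs_grassmann (f i))"
proof -
  have "finite I" by simp
  then show ?thesis
    by (induction I rule: finite_induct)
       (simp_all add: one_grassmann_def flip: times_grassmann.abs_eq)
qed

lemma abs_grassmann_sum:
  "finite A \<Longrightarrow> abs_grassmann (\<Sum>x\<in>A. f x :: ('n::finite, 's::comm_semiring_1) sym)
     = (\<Sum>x\<in>A. abs_grassmann (f x))"
  by (induction A rule: finite_induct) (simp_all add: zero_grassmann_def flip: plus_grassmann.abs_eq)

lemma gbasis_abs: "gbasis I = abs_grassmann (Poly_Mapping.single (monom_of I) 1)"
  by (simp add: gbasis_def gvar.abs_eq flip: abs_grassmann_prod sym_var_prod)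

lemma gscale_gbasis_abs: "c \<odot> gbasis I = abs_grassmann (Poly_Mapping.single (monom_of I) c)"
  by (simp add: gbasis_abs gscale.abs_eq sym_const_def mult_single)

lemma monom_of_eq_iff: "monom_of I = monom_of J \<longleftrightarrow> I = J"
  by (metis lookup_monom_of zero_neq_one subsetI subset_antisym)

lemma gcoord_gscale_gbasis: "gcoord (c \<odot> gbasis I) J = (if I = J then c else 0)"
  by (simp add: gscale_gbasis_abs gcoord.abs_eq lookup_single when_def monom_of_eq_iff)

lemma gcoord_add: "gcoord (v + w) I = gcoord v I + gcoord w I"
  by transfer (simp add: lookup_add)

lemma gcoord_zero: "gcoord 0 I = 0"
  by transfer simp

lemma gcoord_sum_gbasis: "gcoord (\<Sum>I\<in>UNIV. c I \<odot> gbasis I) J = c J"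
proof -
  have "gcoord (\<Sum>I\<in>A. c I \<odot> gbasis I) J = (\<Sum>I\<in>A. gcoord (c I \<odot> gbasis I) J)" for A
    using finite[of A]
    by (induction A rule: finite_induct) (auto simp: gcoord_zero gcoord_add)
  then show ?thesis by (simp add: gcoord_gscale_gbasis)
qed

lemma abs_monomial_nonsquarefree:
  fixes c :: "'s::comm_semiring_1" and m :: "'n::finite \<Rightarrow>\<^sub>0 nat"
  assumes "\<not> Poly_Mapping.lookup m i \<le> 1"
  shows "abs_grassmann (Poly_Mapping.single m c) = 0"
proof -
  let ?s = "Poly_Mapping.single i 1 :: 'n \<Rightarrow>\<^sub>0 nat"
  have "m = ?s + ?s + (m - ?s - ?s)"
    by (rule poly_mapping_eqI) (use assms in \<open>auto simp: lookup_add lookup_minus lookup_single when_def\<close>)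
  then have "Poly_Mapping.single m c = sym_var i * sym_var i * Poly_Mapping.single (m - ?s - ?s) c"
    by (metis (no_types) sym_var_def mult_single mult_1)
  then have "abs_grassmann (Poly_Mapping.single m c) =
      gvar i * gvar i * abs_grassmann (Poly_Mapping.single (m - ?s - ?s) c)"
    by (simp add: gvar.abs_eq times_grassmann.abs_eq)
  then show ?thesis by (simp add: gvar_square)
qed

lemma grassmann_expansion:
  fixes w :: "('n::finite, 's::comm_semiring_1) grassmann"
  shows "w = (\<Sum>I\<in>UNIV. gcoord w I \<odot> gbasis I)"
proof -
  obtain p where w: "w = abs_grassmann p" by (metis Quotient3_abs_rep Quotient3_grassmann)
  have p: "p = (\<Sum>m\<in>Poly_Mapping.keys p. Poly_Mapping.single m (Poly_Mapping.lookup p m))" for p :: "('n, 's) sym"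
    by (rule poly_mapping_eqI) (auto simp: lookup_sum lookup_single when_def in_keys_iff)
  define f where "f m = abs_grassmann (Poly_Mapping.single m (Poly_Mapping.lookup p m))" for m
  have f0: "f m = 0" if "m \<notin> Poly_Mapping.keys p \<or> m \<notin> range monom_of" for m
  proof (cases "m \<in> Poly_Mapping.keys p")
    case False
    then show ?thesis by (simp add: f_def in_keys_iff zero_grassmann_def)
  next
    case True
    have "\<exists>i. \<not> Poly_Mapping.lookup m i \<le> 1"
    proof (rule ccontr)
      assume "\<not> ?thesis"
      then have "m = monom_of {i. Poly_Mapping.lookup m i = 1}"
        by (intro poly_mapping_eqI) (auto simp: lookup_monom_of le_Suc_eq)
      with that True show False by blast
    qed
    then show ?thesis using abs_monomial_nonsquarefree by (auto simp: f_def)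
  qed
  have "w = (\<Sum>m\<in>Poly_Mapping.keys p. f m)"
    unfolding w f_def
    by (subst p) (simp add: abs_grassmann_sum)
  also have "\<dots> = (\<Sum>m\<in>range monom_of. f m)"
    by (rule sum.mono_neutral_cong) (use f0 in auto)
  also have "\<dots> = (\<Sum>I\<in>UNIV. f (monom_of I))"
    by (subst sum.reindex) (auto simp: inj_on_def monom_of_eq_iff)
  finally have "w = (\<Sum>I\<in>UNIV. f (monom_of I))" .
  moreover have "f (monom_of I) = gcoord w I \<odot> gbasis I" for I
    by (simp add: f_def w gscale_gbasis_abs gcoord.abs_eq)
  ultimately show ?thesis by simp
qed

lemma ext_power_iff: "w \<in> ext_power d \<longleftrightarrow> (\<forall>I. card I \<noteq> d \<longrightarrow> gcoord w I = 0)"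
proof
  assume "w \<in> ext_power d"
  then obtain p where "w = abs_grassmann p" "p \<in> sym_homogeneous d" by (auto simp: ext_power_def)
  then show "\<forall>I. card I \<noteq> d \<longrightarrow> gcoord w I = 0"
    by (force simp: gcoord.abs_eq sym_homogeneous_def lookup_monom_of in_keys_iff sum.If_cases)
next
  assume *: "\<forall>I. card I \<noteq> d \<longrightarrow> gcoord w I = 0"
  define p where "p = (\<Sum>I\<in>UNIV. Poly_Mapping.single (monom_of I) (gcoord w I))"
  have "w = abs_grassmann p"
    by (subst grassmann_expansion) (simp add: p_def abs_grassmann_sum gscale_gbasis_abs)
  moreover have "p \<in> sym_homogeneous d"
    unfolding sym_homogeneous_def
  proof (intro CollectI ballI)
    fix m assume "m \<in> Poly_Mapping.keys p"
    then have "\<exists>I\<in>UNIV. Poly_Mapping.lookup (Poly_Mapping.single (monom_of I) (gcoord w I)) m \<noteq> 0"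
      unfolding in_keys_iff p_def lookup_sum by (meson sum.not_neutral_contains_not_neutral)
    then obtain I where "m = monom_of I" "gcoord w I \<noteq> 0"
      by (auto simp: lookup_single when_def split: if_splits)
    with * show "(\<Sum>i\<in>UNIV. Poly_Mapping.lookup m i) = d"
      by (auto simp: lookup_monom_of sum.If_cases)
  qed
  ultimately show "w \<in> ext_power d" by (auto simp: ext_power_def)
qed

(* The condition card B + 1 = d says card B = d - 1 without truncated subtraction. *)

definition tropical_plucker ::
    "nat \<Rightarrow> ('n::finite, 's::idempotent_semifield) grassmann \<Rightarrow> bool" where
  "tropical_plucker d w \<longleftrightarrow>
     w \<in> ext_power d \<and> w \<noteq> 0 \<and>
     (\<forall>A B. card A = d + 1 \<longrightarrow> card B + 1 = d \<longrightarrow>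
       (\<forall>p \<in> A - B.
         (\<Sum>i\<in>A - B. gcoord w (A - {i}) * gcoord w (insert i B)) =
         (\<Sum>i\<in>A - B - {p}. gcoord w (A - {i}) * gcoord w (insert i B))))"

definition elongation ::
    "nat \<Rightarrow> nat \<Rightarrow> ('n::finite, 's::idempotent_semifield) grassmann \<Rightarrow> ('n, 's) grassmann" where
  "elongation d d' w =
     (\<Sum>J | card J = d'. (\<Sum>I | I \<subseteq> J \<and> card I = d. gcoord w I) \<odot> gbasis J)"

end

theory Submission
  imports Defs
begin

text \<open>
  Elements of the Grassmann algebra are determined by their coordinates \<open>gcoord\<close>, so it suffices
  to compare coordinates.  Since \<open>e\<^sub>I \<and> e\<^sub>K\<close> is \<open>e\<^bsub>I \<union> K\<^esub>\<close> for disjoint \<open>I\<close>, \<open>K\<close> and vanishes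
  otherwise, the coordinate of a wedge product \<open>v \<and> w\<close> at \<open>J\<close> is a sum over the ways of splitting
  \<open>J\<close> into two blocks (\<open>gcoord_mult\<close>).  For the second factor \<open>\<Sum>K. e\<^sub>K\<close> over all \<open>K\<close> of size
  \<open>d' - d\<close>, every weight is 1 or 0 according to the size of \<open>J - I\<close>.  As \<open>w\<close> is homogeneous of
  degree \<open>d\<close>, only splittings with \<open>card I = d\<close> and \<open>card J = d'\<close> contribute, each with \<open>w\<^sub>I\<close>, which
  is the definition of the elongation.
\<close>

lemma gcoord_sum: "gcoord (\<Sum>x\<in>A. f x) J = (\<Sum>x\<in>A. gcoord (f x) J)"
  by (induction A rule: infinite_finite_induct) (simp_all add: gcoord_zero gcoord_add)

lemma grassmann_eqI: "(\<And>J. gcoord v J = gcoord w J) \<Longrightarrow> v = w"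
  by (metis (no_types, lifting) ext grassmann_expansion)

lemma gscale_one: "1 \<odot> v = v"
  by transfer (simp add: sym_const_def grassmann_cong.refl)

text \<open>
  On monomials the exponent vectors of \<open>I\<close> and \<open>K\<close> add up.  A common element of \<open>I\<close> and \<open>K\<close> gets
  exponent 2, and the monomial is then killed by the relation \<open>e\<^sub>i\<^sup>2 \<sim> 0\<close>.
\<close>

lemma gscale_gbasis_mult:
  fixes I K :: "'n::finite set" and a b :: "'s::comm_semiring_1"
  shows "(a \<odot> gbasis I) * (b \<odot> gbasis K) =
    (if I \<inter> K = {} then (a * b) \<odot> gbasis (I \<union> K) else 0)"
proof -
  have prod: "(a \<odot> gbasis I) * (b \<odot> gbasis K) =
      abs_grassmann (Poly_Mapping.single (monom_of I + monom_of K) (a * b))"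
    by (simp add: gscale_gbasis_abs times_grassmann.abs_eq mult_single)
  show ?thesis
  proof (cases "I \<inter> K = {}")
    case True
    then have "monom_of I + monom_of K = monom_of (I \<union> K)"
      by (intro poly_mapping_eqI) (auto simp: lookup_add lookup_monom_of)
    with True prod show ?thesis by (simp add: gscale_gbasis_abs)
  next
    case False
    then obtain i where "i \<in> I" "i \<in> K" by blast
    then have "\<not> Poly_Mapping.lookup (monom_of I + monom_of K) i \<le> 1"
      by (simp add: lookup_add lookup_monom_of)
    with False prod show ?thesis by (simp add: abs_monomial_nonsquarefree)
  qed
qed

lemma gcoord_mult:
  fixes v w :: "('n::finite, 's::comm_semiring_1) grassmann"
  shows "gcoord (v * w) J = (\<Sum>I | I \<subseteq> J. gcoord v I * gcoord w (J - I))"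
proof -
  have "v * w =
      (\<Sum>I\<in>UNIV. \<Sum>K\<in>UNIV. (gcoord v I \<odot> gbasis I) * (gcoord w K \<odot> gbasis K))"
    by (subst grassmann_expansion[of v], subst grassmann_expansion[of w])
       (simp add: sum_product)
  then have "gcoord (v * w) J = (\<Sum>I\<in>UNIV. \<Sum>K\<in>UNIV.
      if I \<inter> K = {} \<and> I \<union> K = J then gcoord v I * gcoord w K else 0)"
    by (auto simp: gcoord_sum gscale_gbasis_mult gcoord_gscale_gbasis gcoord_zero intro!: sum.cong)
  also have "\<dots> = (\<Sum>I\<in>UNIV. if I \<subseteq> J then gcoord v I * gcoord w (J - I) else 0)"
  proof (rule sum.cong)
    fix I :: "'n set"
    have "I \<inter> K = {} \<and> I \<union> K = J \<longleftrightarrow> I \<subseteq> J \<and> K = J - I" for K by blast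
    then show "(\<Sum>K\<in>UNIV. if I \<inter> K = {} \<and> I \<union> K = J then gcoord v I * gcoord w K else 0) =
        (if I \<subseteq> J then gcoord v I * gcoord w (J - I) else 0)"
      by simp
  qed simp
  also have "\<dots> = (\<Sum>I | I \<subseteq> J. gcoord v I * gcoord w (J - I))"
    by (simp add: sum.If_cases)
  finally show ?thesis .
qed

lemma gcoord_sum_gscale_gbasis:
  "gcoord (\<Sum>I\<in>A. c I \<odot> gbasis I) J = (if J \<in> A then c J else 0)"
  by (simp add: gcoord_sum gcoord_gscale_gbasis)

lemma gcoord_elongation:
  "gcoord (elongation d d' w) J =
    (if card J = d' then \<Sum>I | I \<subseteq> J \<and> card I = d. gcoord w I else 0)"
  by (simp add: elongation_def gcoord_sum_gscale_gbasis)

text \<open>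
  Multiplying by the sum of all basis vectors of degree \<open>k\<close> spreads each coordinate \<open>w\<^sub>I\<close> with weight
  1 over all supersets of \<open>I\<close> with \<open>k\<close> more elements.  Homogeneity of \<open>w\<close> turns
  \<open>card (J - I) = k\<close> into the condition \<open>card J = d + k\<close>, which no longer depends on \<open>I\<close>.
\<close>

lemma gcoord_mult_sum_gbasis:
  fixes w :: "('n::finite, 's::comm_semiring_1) grassmann"
  assumes w: "w \<in> ext_power d"
  shows "gcoord (w * (\<Sum>K | card K = k. gbasis K)) J =
    (if card J = d + k then \<Sum>I | I \<subseteq> J \<and> card I = d. gcoord w I else 0)"
proof -
  have one_coord: "gcoord (\<Sum>K | card K = k. gbasis K) L = (if card L = k then 1 else 0 :: 's)"
    for L :: "'n set"
    using gcoord_sum_gscale_gbasis[of "\<lambda>_. 1" "{K. card K = k}" L] by (simp add: gscale_one)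
  have split_card: "card (J - I) = k \<longleftrightarrow> card J = d + k" if "I \<subseteq> J" "card I = d" for I
    using that card_mono[of J I] by (auto simp: card_Diff_subset)
  have "gcoord (w * (\<Sum>K | card K = k. gbasis K)) J =
      (\<Sum>I | I \<subseteq> J. if card (J - I) = k then gcoord w I else 0)"
    by (auto simp: gcoord_mult one_coord intro: sum.cong)
  also have "\<dots> = (\<Sum>I | I \<subseteq> J \<and> card I = d. if card (J - I) = k then gcoord w I else 0)"
    by (rule sum.mono_neutral_right) (use w in \<open>auto simp: ext_power_iff\<close>)
  also have "\<dots> = (\<Sum>I | I \<subseteq> J \<and> card I = d. if card J = d + k then gcoord w I else 0)"
    by (rule sum.cong) (simp_all add: split_card)
  finally show ?thesis by simp
qed

theorem proposition5p3p1:
  fixes w :: "('n::finite, 's::idempotent_semifield) grassmann"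
    and d d' :: nat
  assumes "1 \<le> d" and "d \<le> d'" and "d' \<le> CARD('n)"
    and "tropical_plucker d w"
  shows "elongation d d' w = w * (\<Sum>K | card K = d' - d. gbasis K)
    \<and> w * (\<Sum>K | card K = d' - d. gbasis K) \<in> ext_power d'"
proof -
  have "w \<in> ext_power d" using assms(4) by (simp add: tropical_plucker_def)
  note coord = gcoord_mult_sum_gbasis[OF this, of "d' - d"]
  have "elongation d d' w = w * (\<Sum>K | card K = d' - d. gbasis K)"
    by (rule grassmann_eqI) (use assms(2) in \<open>simp add: gcoord_elongation coord\<close>)
  moreover have "w * (\<Sum>K | card K = d' - d. gbasis K) \<in> ext_power d'"
    using assms(2) by (simp add: ext_power_iff coord)
  ultimately show ?thesis by blast
qed

end
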